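(* Let $p\ge0$, $q\ge0$, $m\ge0$ be integers and let $f,g,h$ be entire functions represented by vector valued Dirichlet series such that $f$ has relative index-pair $(m,q)$ and $g$ has relative index-pair $(m,p)$ with respect to $h$. Then $$\left[\frac{\overline{\Delta}_h^{(m,q)}(f)}{\overline{\tau}_h^{(m,p)}(g)}\right]^{\frac{1}{\lambda_h^{(m,p)}(g)}}\le\overline{\Delta}_g^{(p,q)}(f)\le\min\left\{\left[\frac{\overline{\Delta}_h^{(m,q)}(f)}{\overline{\Delta}_h^{(m,p)}(g)}\right]^{\frac{1}{\rho_h^{(m,p)}(g)}},\left[\frac{\Delta_h^{(m,q)}(f)}{\Delta_h^{(m,p)}(g)}\right]^{\frac{1}{\rho_h^{(m,p)}(g)}}\right\}.$$
   Context: VVDS: an entire function represented by a vector valued Dirichlet series is a function $f(s)=\sum_{n\ge1}a_ne^{s\lambda_n}$, $s=\sigma+it$, not identically zero, with $a_n$ in a complex Banach space $(E,\|\cdot\|)$, $0<\lambda_n<\lambda_{n+1}$, $\lambda_n\to+\infty$, $\limsup_{n}\frac{\log n}{\lambda_n}<+\infty$ and $\limsup_{n}\frac{\log\|a_n\|}{\lambda_n}=-\infty$ (so the series converges absolutely everywhere). Its maximum modulus is $M_f(\sigma)=\sup_{t\in\mathbb R}\|f(\sigma+it)\|$, and $M_f^{-1}$ is the inverse function of $M_f$. Iterated logarithms: $\log^{[0]}x=x$, $\log^{[-1]}x=\exp x$, $\log^{[k]}x=\log(\log^{[k-1]}x)$ for $k\ge1$. Index-pair: for $k\ge q+1\ge1$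 let $\rho_f(k,q)=\limsup_{\sigma\to+\infty}\frac{\log^{[k]}M_f(\sigma)}{\log^{[q]}\sigma}$ (the same formula is used for shifted indices). $f$ has index-pair $(1,1)$ if $0<\rho_f(1,1)<\infty$; otherwise $f$ has index-pair $(k,q)\neq(1,1)$, $k\ge q+1\ge1$, if $\delta_{k-q,0}<\rho_f(k,q)<\infty$ and $\rho_f(k-1,q-1)$ is not a positive real number, where $\delta_{i,j}=1$ if $i=j$ and $0$ otherwise. Relative Ritt orders: if $f$ and $g$ have index-pairs $(k,q)$ and $(k,p)$ with $k\ge q+1\ge1$, $k\ge p+1\ge1$, then $$\rho_g^{(p,q)}(f)=\limsup_{\sigma\to+\infty}\frac{\log^{[p]}M_g^{-1}(M_f(\sigma))}{\log^{[q]}\sigma},\qquad \lambda_g^{(p,q)}(f)=\liminf_{\sigma\to+\infty}\frac{\log^{[p]}M_g^{-1}(M_f(\sigma))}{\log^{[q]}\sigma}$$ are the $(p,q)$-th relative Ritt order and lower order of $f$ with respect to $g$. In this situation $f$ has relative index-pair $(p,q)$ with respect to $g$ if $b<\rho_g^{(p,q)}(f)<\infty$ and $\rho_g^{(p-1,q-1)}(f)$ (same formula) is not a nonzero finite number, where $b=1$ if $p=q=k$ and $b=0$ otherwise. Relative types: if $0<\rho_g^{(p,q)}(f)<\infty$, the relative Ritt type $\Delta_g^{(p,q)}(f)$ and lower type $\overline{\Delta}_g^{(p,q)}(f)$ are respectively the $\limsup$ and the $\liminf$ as $\sigma\to+\infty$ of $$\frac{\log^{[p-1]}M_g^{-1}(M_f(\sigma))}{[\log^{[q-1]}\sigma]^{\rho_g^{(p,q)}(f)}}.$$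 If $0<\lambda_g^{(p,q)}(f)<\infty$, the relative Ritt weak type $\tau_g^{(p,q)}(f)$ and the indicator $\overline{\tau}_g^{(p,q)}(f)$ are respectively the $\liminf$ and the $\limsup$ as $\sigma\to+\infty$ of $$\frac{\log^{[p-1]}M_g^{-1}(M_f(\sigma))}{[\log^{[q-1]}\sigma]^{\lambda_g^{(p,q)}(f)}}.$$ For other pairs of functions and indices the definitions are the same with the letters changed. The claim presupposes that all quantities appearing in it are defined, i.e. the corresponding orders or lower orders are positive and finite. Convention: types lie in $[0,\infty]$; quotients are taken with $a/0=\infty$ for $a>0$ and $a/\infty=0$ for $a<\infty$, and relations are asserted when every quotient is meaningful (no $0/0$ or $\infty/\infty$). *)

theory Defs
  imports "HOL-Analysis.Analysis"
begin

class complex_banach = banach +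
  fixes scaleC :: "complex \<Rightarrow> 'a \<Rightarrow> 'a"  (infixr \<open>*\<^sub>C\<close> 75)
  assumes scaleC_add_right: "c *\<^sub>C (x + y) = c *\<^sub>C x + c *\<^sub>C y"
    and scaleC_add_left: "(c + d) *\<^sub>C x = c *\<^sub>C x + d *\<^sub>C x"
    and scaleC_scaleC: "c *\<^sub>C (d *\<^sub>C x) = (c * d) *\<^sub>C x"
    and scaleC_one: "1 *\<^sub>C x = x"
    and scaleR_scaleC: "r *\<^sub>R x = complex_of_real r *\<^sub>C x"
    and norm_scaleC: "norm (c *\<^sub>C x) = cmod c * norm x"

(* Logarithm with log 0 = -\<infinity>; the library's real ln has ln 0 = 0, which would misjudge
   vanishing coefficients. *)
definition ext_ln :: "real \<Rightarrow> ereal" where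
  "ext_ln x = (if x = 0 then -\<infinity> else ereal (ln x))"

(* Coefficients and exponents are indexed from 1; their values at index 0 are irrelevant. *)
definition vvds_entire :: "(complex \<Rightarrow> 'a::complex_banach) \<Rightarrow> bool" where
  "vvds_entire f \<longleftrightarrow>
     (\<exists>s. f s \<noteq> 0) \<and>
     (\<exists>(a :: nat \<Rightarrow> 'a) (l :: nat \<Rightarrow> real).
        (\<forall>n\<ge>1. 0 < l n \<and> l n < l (Suc n)) \<and>
        filterlim l at_top sequentially \<and>
        limsup (\<lambda>n. ereal (ln (real n) / l n)) < \<infinity> \<and>
        limsup (\<lambda>n. ext_ln (norm (a n)) / ereal (l n)) = -\<infinity> \<and>
        (\<forall>s. (\<lambda>n. exp (s * complex_of_real (l (Suc n))) *\<^sub>C a (Suc n)) sums f s))"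

definition max_modulus :: "(complex \<Rightarrow> 'a::complex_banach) \<Rightarrow> real \<Rightarrow> real" where
  "max_modulus f \<sigma> = (SUP t. norm (f (Complex \<sigma> t)))"

(* Used below only for k \<ge> -1, and in limits at +\<infinity>, where all arguments of ln are
   eventually positive. *)
definition iter_log :: "int \<Rightarrow> real \<Rightarrow> real" where
  "iter_log k x = (if k \<ge> 0 then (ln ^^ nat k) x else (exp ^^ nat (- k)) x)"

definition ritt_order :: "(complex \<Rightarrow> 'a::complex_banach) \<Rightarrow> int \<Rightarrow> int \<Rightarrow> ereal" where
  "ritt_order f k q = Limsup at_top (\<lambda>\<sigma>. ereal (iter_log k (max_modulus f \<sigma>) / iter_log q \<sigma>))"

definition pos_finite :: "ereal \<Rightarrow> bool" where
  "pos_finite x \<longleftrightarrow> 0 < x \<and> x < \<infinity>"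

definition index_pair :: "(complex \<Rightarrow> 'a::complex_banach) \<Rightarrow> int \<Rightarrow> int \<Rightarrow> bool" where
  "index_pair f k q \<longleftrightarrow>
     (if k = 1 \<and> q = 1 then pos_finite (ritt_order f 1 1)
      else \<not> pos_finite (ritt_order f 1 1) \<and> k \<ge> q + 1 \<and> q + 1 \<ge> 1 \<and>
           (if k - q = 0 then 1 else 0) < ritt_order f k q \<and> ritt_order f k q < \<infinity> \<and>
           \<not> pos_finite (ritt_order f (k - 1) (q - 1)))"

(* M_g^{-1} (M_f \<sigma>).  For a VVDS, M_g is a bijection from the reals onto the positive reals. *)
definition rel_modulus ::
    "(complex \<Rightarrow> 'b::complex_banach) \<Rightarrow> (complex \<Rightarrow> 'a::complex_banach) \<Rightarrow> real \<Rightarrow> real" where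
  "rel_modulus g f \<sigma> = inv (max_modulus g) (max_modulus f \<sigma>)"

(* In all relative quantities the reference function comes first and the function being
   measured last: rel_order g p q f is \<rho>_g^{(p,q)}(f). *)
definition rel_order ::
    "(complex \<Rightarrow> 'b::complex_banach) \<Rightarrow> int \<Rightarrow> int \<Rightarrow> (complex \<Rightarrow> 'a::complex_banach) \<Rightarrow> ereal" where
  "rel_order g p q f =
     Limsup at_top (\<lambda>\<sigma>. ereal (iter_log p (rel_modulus g f \<sigma>) / iter_log q \<sigma>))"

definition rel_lower_order ::
    "(complex \<Rightarrow> 'b::complex_banach) \<Rightarrow> int \<Rightarrow> int \<Rightarrow> (complex \<Rightarrow> 'a::complex_banach) \<Rightarrow> ereal" where
  "rel_lower_order g p q f =
     Liminf at_top (\<lambda>\<sigma>. ereal (iter_log p (rel_modulus g f \<sigma>) / iter_log q \<sigma>))"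

definition rel_index_pair ::
    "(complex \<Rightarrow> 'b::complex_banach) \<Rightarrow> int \<Rightarrow> int \<Rightarrow> (complex \<Rightarrow> 'a::complex_banach) \<Rightarrow> bool" where
  "rel_index_pair g p q f \<longleftrightarrow>
     (\<exists>k. k \<ge> q + 1 \<and> q + 1 \<ge> 1 \<and> k \<ge> p + 1 \<and> p + 1 \<ge> 1 \<and>
          index_pair f k q \<and> index_pair g k p \<and>
          (if p = q \<and> q = k then 1 else 0) < rel_order g p q f \<and> rel_order g p q f < \<infinity> \<and>
          \<not> (rel_order g (p - 1) (q - 1) f \<noteq> 0 \<and> \<bar>rel_order g (p - 1) (q - 1) f\<bar> \<noteq> \<infinity>))"

(* The next three are meaningful only if the order, respectively lower order, in the exponent
   is positive and finite. *)
definition rel_type ::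
    "(complex \<Rightarrow> 'b::complex_banach) \<Rightarrow> int \<Rightarrow> int \<Rightarrow> (complex \<Rightarrow> 'a::complex_banach) \<Rightarrow> ereal" where
  "rel_type g p q f =
     Limsup at_top (\<lambda>\<sigma>. ereal (iter_log (p - 1) (rel_modulus g f \<sigma>)
       / iter_log (q - 1) \<sigma> powr real_of_ereal (rel_order g p q f)))"

definition rel_lower_type ::
    "(complex \<Rightarrow> 'b::complex_banach) \<Rightarrow> int \<Rightarrow> int \<Rightarrow> (complex \<Rightarrow> 'a::complex_banach) \<Rightarrow> ereal" where
  "rel_lower_type g p q f =
     Liminf at_top (\<lambda>\<sigma>. ereal (iter_log (p - 1) (rel_modulus g f \<sigma>)
       / iter_log (q - 1) \<sigma> powr real_of_ereal (rel_order g p q f)))"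

(* The indicator \<tau>-bar; it is the limsup, the weak type \<tau> being the liminf. *)
definition rel_weak_type_indicator ::
    "(complex \<Rightarrow> 'b::complex_banach) \<Rightarrow> int \<Rightarrow> int \<Rightarrow> (complex \<Rightarrow> 'a::complex_banach) \<Rightarrow> ereal" where
  "rel_weak_type_indicator g p q f =
     Limsup at_top (\<lambda>\<sigma>. ereal (iter_log (p - 1) (rel_modulus g f \<sigma>)
       / iter_log (q - 1) \<sigma> powr real_of_ereal (rel_lower_order g p q f)))"

definition quot_meaningful :: "ereal \<Rightarrow> ereal \<Rightarrow> bool" where
  "quot_meaningful a b \<longleftrightarrow> \<not> (a = 0 \<and> b = 0) \<and> \<not> (a = \<infinity> \<and> b = \<infinity>)"

(* Power of an element of [0,\<infinity>] with positive real exponent. *)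
definition ext_powr :: "ereal \<Rightarrow> real \<Rightarrow> ereal" where
  "ext_powr x r = (if x = \<infinity> then \<infinity> else ereal (real_of_ereal x powr r))"

(* Division on ereal agrees with the usual conventions on [0,\<infinity>]. *)
lemma ereal_quotient_conventions:
  fixes a :: ereal
  shows "a > 0 \<Longrightarrow> a / 0 = \<infinity>" and "0 \<le> a \<Longrightarrow> a < \<infinity> \<Longrightarrow> a / \<infinity> = 0"
  by (cases a; simp add: divide_ereal_def)+

end

theory Submission
  imports Defs
begin

text \<open>The maximum modulus \<open>M\<close> of an entire vector valued Dirichlet series is convex: averaging
  \<open>f\<close> over the four points \<open>s + i\<^sup>k r\<close> reproduces \<open>f(s)\<close> up to \<open>O(r\<^sup>3)\<close>, and since \<open>M\<close> does not
  depend on the imaginary part this gives \<open>M(x + r) + M(x - r) - 2 M(x) \<ge> -C r\<^sup>3\<close>. As \<open>M\<close> is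
  nonzero and tends to 0 at \<open>-\<infinity>\<close>, it takes each positive value exactly once and tends to \<open>\<infinity>\<close>.

  Hence with \<open>u = M\<^sub>h\<^sup>-\<^sup>1 M\<^sub>f\<close>, \<open>v = M\<^sub>h\<^sup>-\<^sup>1 M\<^sub>g\<close>, \<open>w = M\<^sub>g\<^sup>-\<^sup>1 M\<^sub>f\<close> one has \<open>u = v \<circ> w\<close> near \<open>\<infinity>\<close>, which
  factors the quotients defining the orders and types of \<open>f\<close> relative to \<open>h\<close> through those of \<open>g\<close>
  relative to \<open>h\<close> and of \<open>f\<close> relative to \<open>g\<close>. For the orders this yields
  \<open>\<lambda>\<^sub>h(g) \<rho>\<^sub>g(f) \<le> \<rho>\<^sub>h(f) \<le> \<rho>\<^sub>h(g) \<rho>\<^sub>g(f)\<close>, exactly what is needed to compare the exponents in the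
  factorization of the types.\<close>

section \<open>Convexity from second differences\<close>

text \<open>Adding a small multiple \<open>e\<close> of \<open>(x - a) * (x - b)\<close> to the
  deviation from the chord rules out a positive interior maximum: there the second difference would
  be \<le> 0, yet it is at least \<open>2 * e * r^2 - C * r^3\<close>. Afterwards the multiple tends
  to 0.\<close>

lemma second_difference_imp_convex:
  fixes \<phi> :: "real \<Rightarrow> real"
  assumes cont: "continuous_on UNIV \<phi>"
    and diff: "\<And>x. \<exists>C. \<forall>r. 0 < r \<and> r \<le> 1 \<longrightarrow> 2 * \<phi> x \<le> \<phi> (x + r) + \<phi> (x - r) + C * r ^ 3"
  shows "convex_on UNIV \<phi>"
proof (rule convex_on_linorderI)
  fix t a b :: real
  assume t: "0 < t" "t < 1" and ab: "a < b"
  define k where "k = (\<phi> b - \<phi> a) / (b - a)"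
  have kb: "k * (b - a) = \<phi> b - \<phi> a"
    using ab by (simp add: k_def)
  have perturbed: "\<phi> x - (\<phi> a + k * (x - a)) + e * ((x - a) * (x - b)) \<le> 0"
    if e: "0 < e" and x: "a \<le> x" "x \<le> b" for e x
  proof (rule ccontr)
    define \<psi> where "\<psi> x = \<phi> x - (\<phi> a + k * (x - a)) + e * ((x - a) * (x - b))" for x
    assume "\<not> ?thesis"
    then have pos: "\<psi> x > 0" by (simp add: \<psi>_def)
    have "continuous_on {a..b} \<psi>"
      unfolding \<psi>_def
      by (intro continuous_intros continuous_on_subset[OF cont]) auto
    then obtain c where c: "c \<in> {a..b}" and cmax: "\<And>y. y \<in> {a..b} \<Longrightarrow> \<psi> y \<le> \<psi> c"
      using continuous_attains_sup[of "{a..b}" \<psi>] ab by auto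
    have "\<psi> c > 0"
      using pos cmax[of x] x by auto
    moreover have "\<psi> a = 0" "\<psi> b = 0"
      using kb by (auto simp: \<psi>_def)
    ultimately have "c \<noteq> a" "c \<noteq> b"
      by auto
    with c have ci: "a < c" "c < b"
      by auto
    obtain C where C: "\<And>r. 0 < r \<Longrightarrow> r \<le> 1 \<Longrightarrow> 2 * \<phi> c \<le> \<phi> (c + r) + \<phi> (c - r) + C * r ^ 3"
      using diff[of c] by blast
    \<comment> \<open>The bounds keep \<open>c + r\<close> and \<open>c - r\<close> in
      \<open>[a, b]\<close> and give \<open>C * r \<le> e\<close>; the summand 1 avoids division by
      zero.\<close>
    define r where "r = Min {1, c - a, b - c, e / (\<bar>C\<bar> + 1)}"
    have r: "0 < r" "r \<le> 1" "r \<le> c - a" "r \<le> b - c" "r \<le> e / (\<bar>C\<bar> + 1)"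
      using ci e by (auto simp: r_def)
    have "\<psi> (c + r) + \<psi> (c - r) \<le> 2 * \<psi> c"
      using cmax[of "c + r"] cmax[of "c - r"] r ci by auto
    also have "\<psi> (c + r) + \<psi> (c - r) = \<phi> (c + r) + \<phi> (c - r) - 2 * \<phi> c + 2 * \<psi> c + 2 * e * r\<^sup>2"
      by (simp add: \<psi>_def algebra_simps power2_eq_square)
    finally have "2 * e * r\<^sup>2 \<le> 2 * \<phi> c - \<phi> (c + r) - \<phi> (c - r)"
      by simp
    also have "\<dots> \<le> C * r ^ 3"
      using C[of r] r by simp
    also have "\<dots> = r\<^sup>2 * (C * r)"
      by (simp add: power2_eq_square power3_eq_cube)
    also have "\<dots> \<le> r\<^sup>2 * e"
    proof (rule mult_left_mono)
      have "C * r \<le> (\<bar>C\<bar> + 1) * r"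
        using r by (intro mult_right_mono) auto
      also have "\<dots> \<le> e"
        using r(5) by (simp add: field_simps)
      finally show "C * r \<le> e" .
    qed simp
    finally have "r\<^sup>2 * e \<le> 0"
      by (simp add: mult.commute)
    then show False
      using r(1) e by (simp add: mult_le_0_iff)
  qed
  define x where "x = (1 - t) *\<^sub>R a + t *\<^sub>R b"
  have xa: "x - a = t * (b - a)" and xb: "b - x = (1 - t) * (b - a)"
    by (auto simp: x_def algebra_simps)
  have "0 \<le> x - a" "0 \<le> b - x"
    unfolding xa xb using t ab by auto
  then have x: "a \<le> x" "x \<le> b"
    by auto
  have "\<phi> x \<le> \<phi> a + k * (x - a)"
  proof (rule field_le_epsilon)
    fix e :: real assume e: "0 < e"
    define d where "d = (x - a) * (b - x)"
    have d: "d > 0"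
      unfolding d_def xa xb using t ab by simp
    \<comment> \<open>With the multiple \<open>e / d\<close> the quadratic term is exactly
      \<open>- e\<close> at \<open>x\<close>.\<close>
    from perturbed[of "e / d" x] e d x
    have "\<phi> x - (\<phi> a + k * (x - a)) + e / d * (- d) \<le> 0"
      by (simp add: d_def algebra_simps)
    then show "\<phi> x \<le> \<phi> a + k * (x - a) + e"
      using d by simp
  qed
  also have "k * (x - a) = t * (k * (b - a))"
    by (simp add: xa)
  finally show "\<phi> ((1 - t) *\<^sub>R a + t *\<^sub>R b) \<le> (1 - t) * \<phi> a + t * \<phi> b"
    unfolding kb x_def by (simp add: algebra_simps)
qed simp

section \<open>Growth functions and their inverses\<close>

text \<open>Strict increase is asked from points of positive value: convexity and the limit 0 at
  -\<infinity> leave room for a left half-line of zeros, and it is positive values that get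
  inverted.\<close>

definition growth_function :: "(real \<Rightarrow> real) \<Rightarrow> bool" where
  "growth_function M \<longleftrightarrow>
     continuous_on UNIV M \<and> (M \<longlongrightarrow> 0) at_bot \<and> filterlim M at_top at_top \<and>
     (\<forall>x y. x < y \<longrightarrow> 0 < M x \<longrightarrow> M x < M y)"

text \<open>Left of a point with \<open>0 < M x\<close> there is a smaller value, so the chord
  between them has positive slope, and convexity allows no smaller slope further right. Beyond
  \<open>x0 + 1\<close> the graph lies above the line through its points at \<open>x0\<close> and
  \<open>x0 + 1\<close>, which gives the limit \<infinity>.\<close>

lemma convex_imp_growth_function:
  assumes cont: "continuous_on UNIV M" and conv: "convex_on UNIV M"
    and lim: "(M \<longlongrightarrow> 0) at_bot" and pos: "0 < M x0"
  shows "growth_function M"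
proof -
  have chord: "M x * (c - a) \<le> M a * (c - x) + M c * (x - a)" if "a \<le> x" "x \<le> c" "a < c" for a x c
  proof -
    define t where "t = (x - a) / (c - a)"
    have t: "0 \<le> t" "t \<le> 1" and tx: "t * (c - a) = x - a"
      using that by (auto simp: t_def field_simps)
    have "(1 - t) *\<^sub>R a + t *\<^sub>R c = a + t * (c - a)"
      by (simp add: algebra_simps)
    then have "M x \<le> (1 - t) * M a + t * M c"
      using convex_onD[OF conv, of t a c] t by (simp add: tx)
    then have "M x * (c - a) \<le> ((1 - t) * M a + t * M c) * (c - a)"
      using that by (intro mult_right_mono) auto
    also have "\<dots> = M a * ((c - a) - t * (c - a)) + M c * (t * (c - a))"
      by (simp add: algebra_simps)
    finally show ?thesis
      by (simp add: tx)
  qed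
  have strict: "M x < M y" if "x < y" "0 < M x" for x y
  proof -
    have "eventually (\<lambda>z. M z < M x) at_bot"
      using lim that(2) by (rule order_tendstoD)
    moreover have "eventually (\<lambda>z. z < x) at_bot"
      by (rule eventually_gt_at_bot)
    ultimately have "eventually (\<lambda>z. M z < M x \<and> z < x) at_bot"
      by (rule eventually_conj)
    then obtain z where z: "M z < M x" "z < x"
      using eventually_happens'[OF trivial_limit_at_bot_linorder] by blast
    have "M z * (y - x) < M x * (y - x)"
      using z that by simp
    then have "M x * (x - z) < M y * (x - z)"
      using chord[of z x y] z that by (simp add: algebra_simps)
    then show ?thesis
      using z by simp
  qed
  have "filterlim M at_top at_top"
  proof (rule filterlim_at_top_mono)
    define d where "d = M (x0 + 1) - M x0"
    have d: "d > 0"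
      using strict[of x0 "x0 + 1"] pos by (simp add: d_def)
    show "filterlim (\<lambda>x. (M x0 - d * x0) + d * x) at_top at_top"
      by (rule filterlim_tendsto_add_at_top[OF tendsto_const
            filterlim_tendsto_pos_mult_at_top[OF tendsto_const d filterlim_ident]])
    show "eventually (\<lambda>x. (M x0 - d * x0) + d * x \<le> M x) at_top"
      using eventually_gt_at_top[of "x0 + 1"]
    proof eventually_elim
      case (elim x)
      then show ?case
        using chord[of x0 "x0 + 1" x] by (simp add: d_def algebra_simps)
    qed
  qed
  with cont lim strict show ?thesis
    by (simp add: growth_function_def)
qed

lemma growth_function_unique:
  assumes "growth_function M" "M x = M y" "0 < M y"
  shows "x = y"
proof (rule ccontr)
  assume "x \<noteq> y"
  then have "x < y \<or> y < x"
    by auto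
  moreover have "0 < M x"
    using assms(2,3) by simp
  ultimately have "M x < M y \<or> M y < M x"
    using assms(1,3) unfolding growth_function_def by blast
  then show False
    using assms(2) by simp
qed

text \<open>\<open>inv\<close> selects a preimage as soon as one exists, so it suffices to attain
  \<open>y\<close>, by the intermediate value theorem.\<close>

lemma growth_function_inv:
  assumes M: "growth_function M" and y: "0 < y"
  shows "M (inv M y) = y"
proof -
  have "eventually (\<lambda>x. M x < y) at_bot" "eventually (\<lambda>x. y \<le> M x) at_top"
    using M y by (auto simp: growth_function_def order_tendsto_iff filterlim_at_top)
  then obtain a b where a: "M a < y" and b: "y \<le> M b"
    using eventually_happens'[OF trivial_limit_at_bot_linorder]
      eventually_happens'[OF trivial_limit_at_top_linorder] by blast
  have "a \<le> b"
  proof (rule ccontr)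
    assume "\<not> a \<le> b"
    with M b y have "M b < M a"
      by (auto simp: growth_function_def)
    with a b show False
      by simp
  qed
  then have "\<exists>x. a \<le> x \<and> x \<le> b \<and> M x = y"
    using M a b by (intro IVT') (auto simp: growth_function_def intro: continuous_on_subset)
  then show ?thesis
    by (metis f_inv_into_f rangeI)
qed

lemma growth_function_inv_at_top:
  assumes M: "growth_function M" and N: "filterlim N at_top F"
  shows "filterlim (\<lambda>x. inv M (N x)) at_top F"
  unfolding filterlim_at_top
proof
  fix Z
  \<comment> \<open>The maximum with 0 makes \<open>N x\<close> positive, so that
    \<open>inv M\<close> yields a true preimage.\<close>
  have "eventually (\<lambda>x. max 0 (M Z) < N x) F"
    using N unfolding filterlim_at_top_dense by blast
  then show "eventually (\<lambda>x. Z \<le> inv M (N x)) F"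
  proof eventually_elim
    case (elim x)
    then have "M (inv M (N x)) = N x"
      by (intro growth_function_inv[OF M]) auto
    with elim have "M Z < M (inv M (N x))" "0 < M (inv M (N x))"
      by auto
    then show ?case
      using M unfolding growth_function_def by (metis leI less_asym)
  qed
qed

section \<open>Estimates for the maximum modulus\<close>

text \<open>Indices are shifted to start at 0. The growth conditions take the form of absolute
  convergence at every abscissa; the least exponent governs the decay at -\<infinity>.\<close>

locale dirichlet_series =
  fixes f :: "complex \<Rightarrow> 'a::complex_banach" and b :: "nat \<Rightarrow> 'a" and \<mu> :: "nat \<Rightarrow> real"
  assumes exponent_pos: "0 < \<mu> n"
    and exponent_least: "\<mu> 0 \<le> \<mu> n"
    and abs_summable: "summable (\<lambda>n. exp (\<sigma> * \<mu> n) * norm (b n))"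
    and series: "(\<lambda>n. exp (s * complex_of_real (\<mu> n)) *\<^sub>C b n) sums f s"
begin

definition majorant :: "real \<Rightarrow> real" where
  "majorant \<sigma> = (\<Sum>n. exp (\<sigma> * \<mu> n) * norm (b n))"

text \<open>Combinations of shifted copies of \<open>f\<close> are series with multipliers
  \<open>c n\<close>. A factor \<open>exp (k * \<mu> n)\<close> is absorbed by moving the majorant
  \<open>k\<close> to the right, uniformly in the imaginary part.\<close>

lemma norm_multiplier_le:
  assumes G: "(\<lambda>n. (c n * exp (s * complex_of_real (\<mu> n))) *\<^sub>C b n) sums G"
    and c: "\<And>n. cmod (c n) \<le> \<kappa> * exp (k * \<mu> n)"
  shows "norm G \<le> \<kappa> * majorant (Re s + k)"
proof -
  have "norm (\<Sum>n. (c n * exp (s * complex_of_real (\<mu> n))) *\<^sub>C b n)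
      \<le> (\<Sum>n. \<kappa> * (exp ((Re s + k) * \<mu> n) * norm (b n)))"
  proof (rule norm_suminf_le)
    fix n
    have "norm ((c n * exp (s * complex_of_real (\<mu> n))) *\<^sub>C b n)
        = cmod (c n) * (exp (Re s * \<mu> n) * norm (b n))"
      by (simp add: norm_scaleC norm_mult)
    also have "\<dots> \<le> (\<kappa> * exp (k * \<mu> n)) * (exp (Re s * \<mu> n) * norm (b n))"
      by (intro mult_right_mono c) simp
    also have "\<dots> = \<kappa> * (exp ((Re s + k) * \<mu> n) * norm (b n))"
      by (simp add: distrib_right exp_add)
    finally show "norm ((c n * exp (s * complex_of_real (\<mu> n))) *\<^sub>C b n)
        \<le> \<kappa> * (exp ((Re s + k) * \<mu> n) * norm (b n))" .
  qed (intro summable_mult abs_summable)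
  then show ?thesis
    using sums_unique[OF G] by (simp add: majorant_def suminf_mult[OF abs_summable])
qed

lemma norm_le_majorant: "norm (f s) \<le> majorant (Re s)"
  using norm_multiplier_le[of "\<lambda>_. 1" s "f s" 1 0] series[of s] by simp

lemma series_shift:
  "(\<lambda>n. (exp (w * complex_of_real (\<mu> n)) * exp (s * complex_of_real (\<mu> n))) *\<^sub>C b n) sums f (s + w)"
  using series[of "s + w"] by (simp add: distrib_right exp_add mult.commute)

lemma scaleC_diff_left: "(c - d) *\<^sub>C (x::'a) = c *\<^sub>C x - d *\<^sub>C x"
  using scaleC_add_left[of "c - d" d x] by (simp add: eq_diff_eq)

text \<open>Termwise \<open>cmod (exp z - 1) \<le> exp (cmod z) * cmod z\<close>; the linear factor
  \<open>\<mu> n\<close> is bounded by a second exponential, whence the shift by 2.\<close>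

lemma norm_horizontal_diff:
  assumes "\<bar>\<delta>\<bar> \<le> 1"
  shows "norm (f (s + complex_of_real \<delta>) - f s) \<le> \<bar>\<delta>\<bar> * majorant (Re s + 2)"
proof (rule norm_multiplier_le)
  show "(\<lambda>n. ((exp (complex_of_real \<delta> * complex_of_real (\<mu> n)) - 1) * exp (s * complex_of_real (\<mu> n))) *\<^sub>C b n)
      sums (f (s + complex_of_real \<delta>) - f s)"
    using sums_diff[OF series_shift[of "complex_of_real \<delta>" s] series[of s]]
    by (simp add: left_diff_distrib scaleC_diff_left)
  fix n
  have "cmod (exp (complex_of_real \<delta> * complex_of_real (\<mu> n)) - 1)
      \<le> exp (\<bar>\<delta>\<bar> * \<mu> n) * (\<bar>\<delta>\<bar> * \<mu> n)"
    using Taylor_exp_field[of "complex_of_real \<delta> * complex_of_real (\<mu> n)" 0] exponent_pos[of n]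
    by (simp add: norm_mult)
  also have "\<dots> \<le> exp (\<mu> n) * (\<bar>\<delta>\<bar> * exp (\<mu> n))"
  proof (intro mult_mono)
    show "exp (\<bar>\<delta>\<bar> * \<mu> n) \<le> exp (\<mu> n)"
      using assms exponent_pos[of n] by (simp add: mult_left_le_one_le)
    show "\<mu> n \<le> exp (\<mu> n)"
      using exp_ge_add_one_self[of "\<mu> n"] by linarith
  qed (use exponent_pos[of n] in auto)
  also have "\<dots> = \<bar>\<delta>\<bar> * exp (2 * \<mu> n)"
    using exp_of_nat_mult[of 2 "\<mu> n"] by (simp add: power2_eq_square)
  finally show "cmod (exp (complex_of_real \<delta> * complex_of_real (\<mu> n)) - 1) \<le> \<bar>\<delta>\<bar> * exp (2 * \<mu> n)" .
qed

text \<open>The four points are \<open>s + i\<^sup>k r\<close>, over which \<open>1 + z + z\<^sup>2/2\<close> averages to 1; so the error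
  is of third order in \<open>r\<close>.\<close>

lemma norm_four_point:
  assumes r: "0 < r" "r \<le> 1"
  shows "norm (f (s + complex_of_real r) + f (s - complex_of_real r)
      + f (s + \<i> * complex_of_real r) + f (s - \<i> * complex_of_real r) - 4 *\<^sub>C f s)
    \<le> (2 * r ^ 3) * majorant (Re s + 4)"
proof (rule norm_multiplier_le)
  let ?r = "complex_of_real r" and ?m = "\<lambda>n. complex_of_real (\<mu> n)"
  let ?c = "\<lambda>n. exp (?r * ?m n) + exp (- ?r * ?m n) + exp (\<i> * ?r * ?m n) + exp (- (\<i> * ?r) * ?m n) - 4"
  have "(\<lambda>n. 4 *\<^sub>C (exp (s * ?m n) *\<^sub>C b n)) sums (4 *\<^sub>C f s)"
  proof (rule bounded_linear.sums[OF _ series])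
    show "bounded_linear (\<lambda>x::'a. 4 *\<^sub>C x)"
      by (rule bounded_linear_intro[where K = 4])
        (simp_all add: scaleC_add_right scaleR_scaleC scaleC_scaleC norm_scaleC mult.commute)
  qed
  then have "(\<lambda>n. (4 * exp (s * ?m n)) *\<^sub>C b n) sums (4 *\<^sub>C f s)"
    by (simp add: scaleC_scaleC)
  from sums_diff[OF sums_add[OF sums_add[OF sums_add[OF
      series_shift[of ?r s] series_shift[of "- ?r" s]] series_shift[of "\<i> * ?r" s]]
      series_shift[of "- (\<i> * ?r)" s]] this]
  show "(\<lambda>n. (?c n * exp (s * ?m n)) *\<^sub>C b n) sums
      (f (s + ?r) + f (s - ?r) + f (s + \<i> * ?r) + f (s - \<i> * ?r) - 4 *\<^sub>C f s)"
    by (simp add: left_diff_distrib distrib_right scaleC_diff_left scaleC_add_left)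
  fix n
  define E where "E z = exp z - (1 + z + z\<^sup>2 / 2)" for z :: complex
  define x where "x = r * \<mu> n"
  have x: "0 < x" "x \<le> \<mu> n"
    using r exponent_pos[of n] by (auto simp: x_def)
  have E: "cmod (E z) \<le> exp x * x ^ 3 / 2" if "cmod z = x" for z
    using Taylor_exp_field[of z 2] that
    by (simp add: E_def numeral_eq_Suc power2_eq_square power3_eq_cube mult.assoc add.assoc)
  \<comment> \<open>The four points sum to 0, and so do their squares; the Taylor polynomials
    therefore add up to 4.\<close>
  have "?c n = E (of_real x) + E (- of_real x) + E (\<i> * of_real x) + E (- (\<i> * of_real x))"
    by (simp add: E_def x_def power_mult_distrib mult.assoc)
  also have "cmod \<dots> \<le> exp x * x ^ 3 / 2 + exp x * x ^ 3 / 2 + exp x * x ^ 3 / 2 + exp x * x ^ 3 / 2"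
    using x by (intro norm_triangle_mono E) (auto simp: norm_mult)
  also have "\<dots> = 2 * exp x * x ^ 3"
    by simp
  \<comment> \<open>Each factor of \<open>x ^ 3\<close> costs one \<open>exp (\<mu> n)\<close>;
    together with the one bounding \<open>exp x\<close> this makes the shift 4.\<close>
  also have "\<dots> \<le> 2 * exp (\<mu> n) * (r ^ 3 * exp (\<mu> n) ^ 3)"
  proof (intro mult_mono)
    have "x \<le> r * exp (\<mu> n)"
      using exp_ge_add_one_self[of "\<mu> n"] r unfolding x_def by (intro mult_left_mono) linarith+
    then show "x ^ 3 \<le> r ^ 3 * exp (\<mu> n) ^ 3"
      using x by (metis less_imp_le power_mono power_mult_distrib)
  qed (use x in auto)
  also have "\<dots> = 2 * r ^ 3 * exp (4 * \<mu> n)"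
    using exp_of_nat_mult[of 4 "\<mu> n"] by (simp add: numeral_eq_Suc)
  finally show "cmod (?c n) \<le> 2 * r ^ 3 * exp (4 * \<mu> n)" .
qed

text \<open>The supremum is taken in the reals, so boundedness on the vertical line has to be known;
  the majorant supplies it.\<close>

lemma norm_le_max_modulus:
  assumes "Re s = \<sigma>"
  shows "norm (f s) \<le> max_modulus f \<sigma>"
  unfolding max_modulus_def
proof (rule cSUP_upper2)
  show "bdd_above (range (\<lambda>t. norm (f (Complex \<sigma> t))))"
  proof (rule bdd_aboveI2)
    show "norm (f (Complex \<sigma> t)) \<le> majorant \<sigma>" for t
      using norm_le_majorant[of "Complex \<sigma> t"] by simp
  qed
  have "Complex \<sigma> (Im s) = s"
    using assms by (simp add: complex_eq_iff)
  then show "norm (f s) \<le> norm (f (Complex \<sigma> (Im s)))"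
    by simp
qed simp

lemma max_modulus_le:
  assumes "\<And>s. Re s = \<sigma> \<Longrightarrow> norm (f s) \<le> B"
  shows "max_modulus f \<sigma> \<le> B"
  unfolding max_modulus_def using assms by (intro cSUP_least) auto

lemma max_modulus_nonneg: "0 \<le> max_modulus f \<sigma>"
  by (rule order_trans[OF norm_ge_zero norm_le_max_modulus[of "Complex \<sigma> 0"]]) simp

text \<open>The bound for horizontal differences is uniform on vertical lines, so it passes to the
  suprema, in both directions.\<close>

lemma continuous_max_modulus: "continuous_on UNIV (max_modulus f)"
proof -
  have "isCont (max_modulus f) \<sigma>" for \<sigma>
    unfolding isCont_iff
  proof (rule LIM_zero_cancel, rule Lim_null_comparison)
    show "((\<lambda>\<delta>. \<bar>\<delta>\<bar> * majorant (\<sigma> + 2)) \<longlongrightarrow> 0) (at 0)"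
      by (auto intro!: tendsto_eq_intros)
    have "eventually (\<lambda>\<delta>::real. \<bar>\<delta>\<bar> < 1) (at 0)"
      by (auto simp: eventually_at intro!: exI[of _ 1])
    then show "eventually (\<lambda>\<delta>. norm (max_modulus f (\<sigma> + \<delta>) - max_modulus f \<sigma>)
        \<le> \<bar>\<delta>\<bar> * majorant (\<sigma> + 2)) (at 0)"
    proof eventually_elim
      case (elim \<delta>)
      have d: "norm (f (s + of_real \<delta>) - f s) \<le> \<bar>\<delta>\<bar> * majorant (\<sigma> + 2)" if "Re s = \<sigma>" for s
        using norm_horizontal_diff[of \<delta> s] elim that by simp
      have "max_modulus f (\<sigma> + \<delta>) \<le> max_modulus f \<sigma> + \<bar>\<delta>\<bar> * majorant (\<sigma> + 2)"
      proof (rule max_modulus_le)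
        fix s assume s: "Re s = \<sigma> + \<delta>"
        have "norm (f s) \<le> norm (f (s - of_real \<delta>)) + norm (f s - f (s - of_real \<delta>))"
          using norm_triangle_ineq[of "f (s - of_real \<delta>)" "f s - f (s - of_real \<delta>)"] by simp
        also have "\<dots> \<le> max_modulus f \<sigma> + \<bar>\<delta>\<bar> * majorant (\<sigma> + 2)"
          using d[of "s - of_real \<delta>"] s by (intro add_mono norm_le_max_modulus) auto
        finally show "norm (f s) \<le> \<dots>" .
      qed
      moreover have "max_modulus f \<sigma> \<le> max_modulus f (\<sigma> + \<delta>) + \<bar>\<delta>\<bar> * majorant (\<sigma> + 2)"
      proof (rule max_modulus_le)
        fix s assume s: "Re s = \<sigma>"
        have "norm (f s) \<le> norm (f (s + of_real \<delta>)) + norm (f (s + of_real \<delta>) - f s)"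
          using norm_triangle_ineq4[of "f (s + of_real \<delta>)" "f (s + of_real \<delta>) - f s"] by simp
        also have "\<dots> \<le> max_modulus f (\<sigma> + \<delta>) + \<bar>\<delta>\<bar> * majorant (\<sigma> + 2)"
          using d[of s] s by (intro add_mono norm_le_max_modulus) auto
        finally show "norm (f s) \<le> \<dots>" .
      qed
      ultimately show ?case
        by (simp add: abs_le_iff)
    qed
  qed
  then show ?thesis
    by (simp add: continuous_on_eq_continuous_at)
qed

lemma convex_max_modulus: "convex_on UNIV (max_modulus f)"
proof (rule second_difference_imp_convex[OF continuous_max_modulus])
  let ?M = "max_modulus f"
  fix \<sigma>
  have "2 * ?M \<sigma> \<le> ?M (\<sigma> + r) + ?M (\<sigma> - r) + 2 * majorant (\<sigma> + 4) * r ^ 3"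
    if r: "0 < r" "r \<le> 1" for r
  proof -
    have "?M \<sigma> \<le> (?M (\<sigma> + r) + ?M (\<sigma> - r) + 2 * ?M \<sigma> + 2 * majorant (\<sigma> + 4) * r ^ 3) / 4"
    proof (rule max_modulus_le)
      fix s assume s: "Re s = \<sigma>"
      let ?S = "f (s + of_real r) + f (s - of_real r) + f (s + \<i> * of_real r) + f (s - \<i> * of_real r)"
      have "4 * norm (f s) = norm (4 *\<^sub>C f s)"
        by (simp add: norm_scaleC)
      also have "\<dots> \<le> norm ?S + norm (?S - 4 *\<^sub>C f s)"
        using norm_triangle_ineq4[of ?S "?S - 4 *\<^sub>C f s"] by simp
      \<comment> \<open>Vertical moves stay on the line, so two of the four points contribute
        \<open>?M \<sigma>\<close> each; these cancel against the left side once the supremum over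
        \<open>s\<close> is taken.\<close>
      also have "\<dots> \<le> (?M (\<sigma> + r) + ?M (\<sigma> - r) + ?M \<sigma> + ?M \<sigma>) + (2 * r ^ 3) * majorant (\<sigma> + 4)"
        using norm_four_point[of r s] r s
        by (intro add_mono norm_triangle_mono norm_le_max_modulus) auto
      finally show "norm (f s) \<le> (?M (\<sigma> + r) + ?M (\<sigma> - r) + 2 * ?M \<sigma> + 2 * majorant (\<sigma> + 4) * r ^ 3) / 4"
        by (simp add: mult_ac)
    qed
    then show ?thesis
      by simp
  qed
  then show "\<exists>C. \<forall>r. 0 < r \<and> r \<le> 1 \<longrightarrow> 2 * ?M \<sigma> \<le> ?M (\<sigma> + r) + ?M (\<sigma> - r) + C * r ^ 3"
    by blast
qed

text \<open>For \<sigma> \<le> 0 every \<open>exp (\<sigma> * \<mu> n)\<close> is at most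
  \<open>exp (\<mu> 0 * \<sigma>)\<close>, as \<open>\<mu> 0\<close> is the least exponent; being
  positive, it forces decay.\<close>

lemma max_modulus_at_bot: "(max_modulus f \<longlongrightarrow> 0) at_bot"
proof (rule tendsto_sandwich)
  show "eventually (\<lambda>\<sigma>. 0 \<le> max_modulus f \<sigma>) at_bot"
    by (simp add: max_modulus_nonneg)
  show "eventually (\<lambda>\<sigma>. max_modulus f \<sigma> \<le> exp (\<mu> 0 * \<sigma>) * majorant 0) at_bot"
    using eventually_le_at_bot[of 0]
  proof eventually_elim
    case (elim \<sigma>)
    have "max_modulus f \<sigma> \<le> majorant \<sigma>"
      using norm_le_majorant by (auto intro: max_modulus_le)
    also have "\<dots> \<le> (\<Sum>n. exp (\<mu> 0 * \<sigma>) * (exp (0 * \<mu> n) * norm (b n)))"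
      unfolding majorant_def
    proof (intro suminf_le abs_summable summable_mult)
      fix n
      have "\<sigma> * \<mu> n \<le> \<mu> 0 * \<sigma>"
        using mult_left_mono_neg[OF exponent_least[of n] elim] by (simp add: mult.commute)
      then show "exp (\<sigma> * \<mu> n) * norm (b n) \<le> exp (\<mu> 0 * \<sigma>) * (exp (0 * \<mu> n) * norm (b n))"
        by (simp add: mult_right_mono)
    qed
    also have "\<dots> = exp (\<mu> 0 * \<sigma>) * majorant 0"
      unfolding majorant_def by (intro suminf_mult abs_summable)
    finally show ?case .
  qed
  have "filterlim (\<lambda>\<sigma>. \<mu> 0 * \<sigma>) at_bot at_bot"
    using exponent_pos[of 0]
    by (intro filterlim_tendsto_pos_mult_at_bot[OF tendsto_const] filterlim_ident)
  then have "((\<lambda>\<sigma>. exp (\<mu> 0 * \<sigma>)) \<longlongrightarrow> 0) at_bot"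
    by (rule filterlim_compose[OF exp_at_bot])
  then show "((\<lambda>\<sigma>. exp (\<mu> 0 * \<sigma>) * majorant 0) \<longlongrightarrow> 0) at_bot"
    by (rule tendsto_mult_left_zero)
qed simp

lemma growth_function_max_modulus:
  assumes "f s \<noteq> 0"
  shows "growth_function (max_modulus f)"
proof (rule convex_imp_growth_function)
  have "0 < norm (f s)"
    using assms by simp
  also have "\<dots> \<le> max_modulus f (Re s)"
    by (rule norm_le_max_modulus) simp
  finally show "0 < max_modulus f (Re s)" .
qed (rule continuous_max_modulus convex_max_modulus max_modulus_at_bot)+

end

section \<open>From the series to growth functions\<close>

text \<open>Comparison with the sum of the inverse squares: a bound \<open>D * l n\<close> for
  \<open>ln (real n)\<close> and a bound \<open>(- \<sigma> - 2 * D) * l n\<close> for the logarithm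
  of the coefficient add up to the exponent \<open>- 2 * ln (real n)\<close>.\<close>

lemma vvds_abs_summable:
  fixes a :: "nat \<Rightarrow> 'a::real_normed_vector"
  assumes pos: "\<And>n. 1 \<le> n \<Longrightarrow> 0 < l n"
    and density: "limsup (\<lambda>n. ereal (ln (real n) / l n)) < \<infinity>"
    and decay: "limsup (\<lambda>n. ext_ln (norm (a n)) / ereal (l n)) = -\<infinity>"
  shows "summable (\<lambda>n. exp (\<sigma> * l n) * norm (a n))"
proof -
  obtain D where "limsup (\<lambda>n. ereal (ln (real n) / l n)) < ereal D"
    using density by (meson less_PInf_Ex_of_nat ereal_less_PInfty ereal_dense2)
  then have "eventually (\<lambda>n. ereal (ln (real n) / l n) < ereal D) sequentially"
    by (rule Limsup_lessD)
  moreover have "eventually (\<lambda>n. ext_ln (norm (a n)) / ereal (l n) < ereal (- \<sigma> - 2 * D)) sequentially"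
    by (rule Limsup_lessD) (simp add: decay)
  moreover have "eventually (\<lambda>n. 1 \<le> n) sequentially"
    by (rule eventually_ge_at_top)
  ultimately have "eventually (\<lambda>n. norm (exp (\<sigma> * l n) * norm (a n)) \<le> inverse (real n ^ 2)) sequentially"
  proof eventually_elim
    case (elim n)
    have l: "0 < l n"
      using pos elim by simp
    show ?case
    proof (cases "a n = 0")
      \<comment> \<open>Here \<open>ext_ln\<close> is the real logarithm; a zero coefficient
        satisfies the bound trivially.\<close>
      case False
      have "ln (norm (a n)) < (- \<sigma> - 2 * D) * l n"
        using elim(2) False l by (simp add: ext_ln_def divide_less_eq)
      moreover have "ln (real n) < D * l n"
        using elim(1) l by (simp add: divide_less_eq)
      ultimately have "\<sigma> * l n + ln (norm (a n)) \<le> - 2 * ln (real n)"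
        by (simp add: algebra_simps)
      then have "exp (\<sigma> * l n + ln (norm (a n))) \<le> exp (- 2 * ln (real n))"
        by simp
      then have "exp (\<sigma> * l n) * norm (a n) \<le> exp (- (2 * ln (real n)))"
        using False by (simp add: exp_add)
      also have "\<dots> = inverse (real n ^ 2)"
        using elim(3) exp_of_nat_mult[of 2 "ln (real n)"] by (simp add: exp_minus)
      finally show ?thesis
        by simp
    qed simp
  qed
  then show ?thesis
    by (rule summable_comparison_test_ev) (intro inverse_power_summable order_refl)
qed

lemma vvds_growth_function:
  assumes "vvds_entire f"
  shows "growth_function (max_modulus f)"
proof -
  from assms obtain a l s where s: "f s \<noteq> 0"
    and l: "\<forall>n\<ge>1. 0 < l n \<and> l n < l (Suc n)"
    and lim: "limsup (\<lambda>n. ereal (ln (real n) / l n)) < \<infinity>"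
      "limsup (\<lambda>n. ext_ln (norm (a n)) / ereal (l n)) = -\<infinity>"
    and f: "\<forall>s. (\<lambda>n. exp (s * complex_of_real (l (Suc n))) *\<^sub>C a (Suc n)) sums f s"
    unfolding vvds_entire_def by - (elim conjE exE, rule that)
  interpret dirichlet_series f "\<lambda>n. a (Suc n)" "\<lambda>n. l (Suc n)"
  proof
    show "0 < l (Suc n)" for n
      using l by simp
    have "incseq (\<lambda>n. l (Suc n))"
      by (rule incseq_SucI) (use l in \<open>auto intro: less_imp_le\<close>)
    then show "l (Suc 0) \<le> l (Suc n)" for n
      using incseqD[of "\<lambda>n. l (Suc n)" 0 n] by simp
    show "summable (\<lambda>n. exp (\<sigma> * l (Suc n)) * norm (a (Suc n)))" for \<sigma>
      using vvds_abs_summable[OF _ lim, of \<sigma>] l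
      unfolding summable_Suc_iff[of "\<lambda>n. exp (\<sigma> * l n) * norm (a n)"] by blast
  qed (rule f[rule_format])
  show ?thesis
    using growth_function_max_modulus[OF s] .
qed

section \<open>Upper and lower limits under change of variable\<close>

lemma Limsup_filterlim_le:
  fixes Y :: "'b \<Rightarrow> 'c::complete_linorder"
  assumes "filterlim w G F"
  shows "Limsup F (\<lambda>x. Y (w x)) \<le> Limsup G Y"
  unfolding Limsup_le_iff
  using assms by (auto dest: Limsup_lessD intro: eventually_compose_filterlim)

lemma Liminf_filterlim_ge:
  fixes Y :: "'b \<Rightarrow> 'c::complete_linorder"
  assumes "filterlim w G F"
  shows "Liminf G Y \<le> Liminf F (\<lambda>x. Y (w x))"
  unfolding le_Liminf_iff
  using assms by (auto dest: less_LiminfD intro: eventually_compose_filterlim)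

text \<open>Composition with \<open>w\<close> could lower a limsup by skipping values; the right
  inverse \<open>w'\<close> shows that none are skipped eventually.\<close>

lemma Limsup_filterlim_eq:
  fixes Y :: "'b \<Rightarrow> 'c::complete_linorder"
  assumes w: "filterlim w G F" and w': "filterlim w' F G"
    and right_inv: "eventually (\<lambda>x. w (w' x) = x) G"
  shows "Limsup F (\<lambda>x. Y (w x)) = Limsup G Y"
proof (rule antisym)
  have "Limsup G Y = Limsup G (\<lambda>x. Y (w (w' x)))"
    by (rule Limsup_eq) (use right_inv in eventually_elim, simp)
  also have "\<dots> \<le> Limsup F (\<lambda>x. Y (w x))"
    by (rule Limsup_filterlim_le[OF w'])
  finally show "Limsup G Y \<le> Limsup F (\<lambda>x. Y (w x))" .
qed (rule Limsup_filterlim_le[OF w])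

lemma frequently_le_imp_Liminf_le_Limsup:
  fixes X Y :: "'b \<Rightarrow> 'c::complete_linorder"
  assumes "frequently (\<lambda>x. X x \<le> Y x) F"
  shows "Liminf F X \<le> Limsup F Y"
proof (rule ccontr)
  assume "\<not> ?thesis"
  then have less: "Limsup F Y < Liminf F X"
    by simp
  have "eventually (\<lambda>x. Y x < X x) F"
  proof (cases "\<exists>z. Limsup F Y < z \<and> z < Liminf F X")
    case True
    then obtain z where "Limsup F Y < z" "z < Liminf F X"
      by blast
    then have "eventually (\<lambda>x. Y x < z) F" "eventually (\<lambda>x. z < X x) F"
      by (auto dest: Limsup_lessD less_LiminfD)
    then show ?thesis
      by eventually_elim simp
  next
    \<comment> \<open>In a gap of the order, lying below its upper end means lying at or below its
      lower end.\<close>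
    case False
    have "eventually (\<lambda>x. Y x < Liminf F X) F" "eventually (\<lambda>x. Limsup F Y < X x) F"
      using less by (auto dest: Limsup_lessD less_LiminfD)
    then show ?thesis
      by eventually_elim (use False in \<open>meson leI le_less_trans less_le_trans\<close>)
  qed
  then show False
    using assms by (simp add: frequently_def not_le)
qed

section \<open>Roots of quotients in the extended reals\<close>

text \<open>If \<open>T = 0\<close>, the inequality forces \<open>D = 0\<close>, the excluded 0/0;
  if \<open>T\<close> is infinite, \<open>D\<close> is finite and the quotient is 0. Otherwise both
  are real and the root is monotone.\<close>

lemma ext_powr_quotient_le:
  assumes "0 \<le> D" "0 \<le> T" "quot_meaningful D T" "0 < r" "0 < y"
    and le: "D \<le> ereal (y powr r) * T"
  shows "ext_powr (D / T) (1 / r) \<le> ereal y"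
proof (cases T)
  case (real t)
  show ?thesis
  proof (cases "t = 0")
    case True
    with real have "T = 0"
      by (simp add: zero_ereal_def)
    with le assms(1) have "D = 0"
      by simp
    with \<open>T = 0\<close> assms(3) show ?thesis
      by (simp add: quot_meaningful_def)
  next
    case False
    with assms real have t: "0 < t"
      by simp
    obtain d where d: "D = ereal d" "0 \<le> d"
      using assms real by (cases D) auto
    then have "d / t \<le> y powr r"
      using le real t by (simp add: divide_le_eq)
    then have "(d / t) powr (1 / r) \<le> (y powr r) powr (1 / r)"
      using d t assms by (intro powr_mono2) auto
    then show ?thesis
      using d t real assms by (simp add: ext_powr_def powr_powr)
  qed
next
  case PInf
  with assms obtain d where "D = ereal d"
    by (cases D) (auto simp: quot_meaningful_def)
  then show ?thesis
    using PInf assms by (simp add: ext_powr_def)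
qed (use assms in simp)

text \<open>Apart from an infinite quotient, \<open>T = 0\<close> would make the quotient infinite
  and \<open>T = \<infinity>\<close> would force \<open>D = \<infinity>\<close>, so both are
  real.\<close>

lemma le_ext_powr_quotient:
  assumes "0 \<le> D" "0 \<le> T" "quot_meaningful D T" "0 < r" "0 < y"
    and le: "ereal (y powr r) * T \<le> D"
  shows "ereal y \<le> ext_powr (D / T) (1 / r)"
proof (cases "D / T = \<infinity>")
  case False
  have "T \<noteq> 0"
  proof
    assume "T = 0"
    with assms have "D > 0"
      by (auto simp: quot_meaningful_def order_less_le)
    with \<open>T = 0\<close> False show False
      by (cases D) (auto simp: divide_ereal_def)
  qed
  moreover have "T \<noteq> \<infinity>"
    using assms by (auto simp: quot_meaningful_def)
  ultimately obtain t where t: "T = ereal t" "0 < t"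
    using assms by (cases T) auto
  with False obtain d where d: "D = ereal d" "0 \<le> d"
    using assms by (cases D) (auto simp: divide_ereal_def)
  have "y powr r \<le> d / t"
    using le d t by (simp add: le_divide_eq)
  then have "(y powr r) powr (1 / r) \<le> (d / t) powr (1 / r)"
    using assms by (intro powr_mono2) auto
  then show ?thesis
    using d t assms by (simp add: ext_powr_def powr_powr)
qed (simp add: ext_powr_def)

lemma ext_powr_nonneg: "0 \<le> ext_powr x r"
  by (simp add: ext_powr_def)

section \<open>Orders and types under composition\<close>

text \<open>To be applied with \<open>\<alpha> = log\<^bsup>[m-1]\<^esup> \<circ> v\<close>, \<open>a = log\<^bsup>[m-1]\<^esup> \<circ> u\<close>, \<open>b = log\<^bsup>[p-1]\<^esup>\<close>, \<open>c = log\<^bsup>[q-1]\<^esup>\<close> and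
  \<open>w' = M\<^sub>f\<^sup>-\<^sup>1 M\<^sub>g\<close>; \<open>\<rho>f\<close> and \<open>\<rho>g\<close>, \<open>\<kappa>\<close> are the order of \<open>f\<close> and the order and lower order of \<open>g\<close>
  relative to \<open>h\<close>.\<close>

locale composed_growth =
  fixes a \<alpha> b c w w' :: "real \<Rightarrow> real" and \<rho>f \<rho>g \<kappa> \<rho> :: real
  assumes a: "eventually (\<lambda>\<sigma>. a \<sigma> = \<alpha> (w \<sigma>)) at_top"
    and \<alpha>_top: "filterlim \<alpha> at_top at_top" and b_top: "filterlim b at_top at_top"
    and c_top: "filterlim c at_top at_top" and w_top: "filterlim w at_top at_top"
    and w'_top: "filterlim w' at_top at_top"
    and w_w': "eventually (\<lambda>x. w (w' x) = x) at_top"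
    and order_f: "Limsup at_top (\<lambda>\<sigma>. ereal (ln (a \<sigma>) / ln (c \<sigma>))) = ereal \<rho>f"
    and order_g: "Limsup at_top (\<lambda>x. ereal (ln (\<alpha> x) / ln (b x))) = ereal \<rho>g"
    and lower_order_g: "Liminf at_top (\<lambda>x. ereal (ln (\<alpha> x) / ln (b x))) = ereal \<kappa>"
    and order: "Limsup at_top (\<lambda>\<sigma>. ereal (ln (b (w \<sigma>)) / ln (c \<sigma>))) = ereal \<rho>"
    and pos: "0 < \<rho>f" "0 < \<rho>g" "0 < \<kappa>" "0 < \<rho>"
begin

text \<open>The threshold 1 makes the logarithms positive and powers of \<open>c \<sigma>\<close>
  increasing in the exponent.\<close>

lemma eventually_large:
  "eventually (\<lambda>\<sigma>. 1 < c \<sigma> \<and> 1 < b (w \<sigma>) \<and> 1 < \<alpha> (w \<sigma>) \<and> a \<sigma> = \<alpha> (w \<sigma>)) at_top"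
  using c_top filterlim_compose[OF b_top w_top] filterlim_compose[OF \<alpha>_top w_top] a
  by (auto simp: filterlim_at_top_dense intro!: eventually_conj)

text \<open>The quotient \<open>ln (a \<sigma>) / ln (c \<sigma>)\<close> is the product of those
  for \<open>g\<close> and for \<open>w\<close>, and each factor is eventually below its limsup plus
  \<open>e\<close>.\<close>

lemma order_f_le: "\<rho>f \<le> \<rho>g * \<rho>"
proof (rule tendsto_lowerbound)
  show "((\<lambda>e. (\<rho>g + e) * (\<rho> + e)) \<longlongrightarrow> \<rho>g * \<rho>) (at_right 0)"
    by (auto intro!: tendsto_eq_intros)
  show "eventually (\<lambda>e. \<rho>f \<le> (\<rho>g + e) * (\<rho> + e)) (at_right 0)"
    using eventually_at_right_less[of 0]
  proof eventually_elim
    case (elim e)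
    have "eventually (\<lambda>x. ereal (ln (\<alpha> x) / ln (b x)) < ereal (\<rho>g + e)) at_top"
      by (rule Limsup_lessD) (simp add: order_g elim)
    then have "eventually (\<lambda>\<sigma>. ereal (ln (\<alpha> (w \<sigma>)) / ln (b (w \<sigma>))) < ereal (\<rho>g + e)) at_top"
      by (rule eventually_compose_filterlim[OF _ w_top])
    moreover have "eventually (\<lambda>\<sigma>. ereal (ln (b (w \<sigma>)) / ln (c \<sigma>)) < ereal (\<rho> + e)) at_top"
      by (rule Limsup_lessD) (simp add: order elim)
    ultimately have "eventually (\<lambda>\<sigma>. ereal (ln (a \<sigma>) / ln (c \<sigma>)) \<le> ereal ((\<rho>g + e) * (\<rho> + e))) at_top"
      using eventually_large
    proof eventually_elim
      case (elim \<sigma>)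
      then have ln: "0 < ln (c \<sigma>)" "0 < ln (b (w \<sigma>))"
        by auto
      have "ln (a \<sigma>) \<le> (\<rho>g + e) * ln (b (w \<sigma>))"
        using elim ln by (simp add: divide_less_eq less_imp_le)
      also have "\<dots> \<le> (\<rho>g + e) * ((\<rho> + e) * ln (c \<sigma>))"
        using elim ln pos \<open>0 < e\<close> by (intro mult_left_mono) (auto simp: divide_less_eq less_imp_le)
      finally show ?case
        using ln by (simp add: divide_le_eq mult.assoc)
    qed
    from Limsup_bounded[OF this] show ?case
      by (simp add: order_f)
  qed
qed simp

text \<open>The same factorization, solved for the quotient of \<open>w\<close>: it is eventually at
  most \<open>(\<rho>f + e) / (\<kappa> - e)\<close>.\<close>

lemma lower_order_times_order_le: "\<kappa> * \<rho> \<le> \<rho>f"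
proof (rule tendsto_le[OF trivial_limit_at_right_real])
  show "((\<lambda>e. (\<kappa> - e) * \<rho>) \<longlongrightarrow> \<kappa> * \<rho>) (at_right 0)" "((\<lambda>e. \<rho>f + e) \<longlongrightarrow> \<rho>f) (at_right 0)"
    by (auto intro!: tendsto_eq_intros)
  show "eventually (\<lambda>e. (\<kappa> - e) * \<rho> \<le> \<rho>f + e) (at_right 0)"
    \<comment> \<open>The second fact gives \<open>e < \<kappa>\<close>, which keeps the denominator
      positive.\<close>
    using eventually_at_right_less[of 0] eventually_at_right_real[OF pos(3)]
  proof eventually_elim
    case (elim e)
    have "eventually (\<lambda>x. ereal (\<kappa> - e) < ereal (ln (\<alpha> x) / ln (b x))) at_top"
      by (rule less_LiminfD) (use elim in \<open>simp add: lower_order_g\<close>)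
    then have "eventually (\<lambda>\<sigma>. ereal (\<kappa> - e) < ereal (ln (\<alpha> (w \<sigma>)) / ln (b (w \<sigma>)))) at_top"
      by (rule eventually_compose_filterlim[OF _ w_top])
    moreover have "eventually (\<lambda>\<sigma>. ereal (ln (a \<sigma>) / ln (c \<sigma>)) < ereal (\<rho>f + e)) at_top"
      by (rule Limsup_lessD) (use elim in \<open>simp add: order_f\<close>)
    ultimately have "eventually (\<lambda>\<sigma>. ereal (ln (b (w \<sigma>)) / ln (c \<sigma>)) \<le> ereal ((\<rho>f + e) / (\<kappa> - e))) at_top"
      using eventually_large
    proof eventually_elim
      case (elim \<sigma>)
      then have ln: "0 < ln (c \<sigma>)" "0 < ln (b (w \<sigma>))"
        by auto
      have "(\<kappa> - e) * ln (b (w \<sigma>)) \<le> ln (a \<sigma>)"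
        using elim ln by (simp add: less_divide_eq less_imp_le)
      also have "\<dots> \<le> (\<rho>f + e) * ln (c \<sigma>)"
        using elim ln by (simp add: divide_less_eq less_imp_le)
      finally show ?case
        using ln \<open>e \<in> {0<..<\<kappa>}\<close> by (simp add: field_simps)
    qed
    from Limsup_bounded[OF this] show ?case
      using elim by (simp add: order field_simps)
  qed
qed

lemma quotients_eventually_pos:
  "eventually (\<lambda>\<sigma>. 0 < a \<sigma> / c \<sigma> powr r) at_top"
  "eventually (\<lambda>x. 0 < \<alpha> x / b x powr r) at_top"
  "eventually (\<lambda>\<sigma>. 0 < b (w \<sigma>) / c \<sigma> powr r) at_top"
proof -
  show "eventually (\<lambda>\<sigma>. 0 < a \<sigma> / c \<sigma> powr r) at_top"
    "eventually (\<lambda>\<sigma>. 0 < b (w \<sigma>) / c \<sigma> powr r) at_top"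
    using eventually_large by (eventually_elim, simp)+
  have "eventually (\<lambda>x. 0 < \<alpha> x) at_top" "eventually (\<lambda>x. 0 < b x) at_top"
    using \<alpha>_top b_top by (auto simp: filterlim_at_top_dense)
  then show "eventually (\<lambda>x. 0 < \<alpha> x / b x powr r) at_top"
    by eventually_elim simp
qed

lemma types_nonneg:
  "0 \<le> Liminf at_top (\<lambda>\<sigma>. ereal (a \<sigma> / c \<sigma> powr r))"
  "0 \<le> Liminf at_top (\<lambda>x. ereal (\<alpha> x / b x powr r))"
  "0 \<le> Liminf at_top (\<lambda>\<sigma>. ereal (b (w \<sigma>) / c \<sigma> powr r))"
  "0 \<le> Limsup at_top (\<lambda>\<sigma>. ereal (a \<sigma> / c \<sigma> powr r))"
  "0 \<le> Limsup at_top (\<lambda>x. ereal (\<alpha> x / b x powr r))"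
proof -
  have "eventually (\<lambda>\<sigma>. 0 \<le> ereal (a \<sigma> / c \<sigma> powr r)) at_top"
    "eventually (\<lambda>x. 0 \<le> ereal (\<alpha> x / b x powr r)) at_top"
    "eventually (\<lambda>\<sigma>. 0 \<le> ereal (b (w \<sigma>) / c \<sigma> powr r)) at_top"
    using quotients_eventually_pos[of r] by (eventually_elim, simp)+
  then show "0 \<le> Liminf at_top (\<lambda>\<sigma>. ereal (a \<sigma> / c \<sigma> powr r))"
    "0 \<le> Liminf at_top (\<lambda>x. ereal (\<alpha> x / b x powr r))"
    "0 \<le> Liminf at_top (\<lambda>\<sigma>. ereal (b (w \<sigma>) / c \<sigma> powr r))"
    "0 \<le> Limsup at_top (\<lambda>\<sigma>. ereal (a \<sigma> / c \<sigma> powr r))"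
    "0 \<le> Limsup at_top (\<lambda>x. ereal (\<alpha> x / b x powr r))"
    by - (rule Liminf_bounded le_Limsup[OF trivial_limit_at_top_linorder], assumption)+
qed

text \<open>The powers of \<open>b (w \<sigma>)\<close> cancel. Applied with
  \<open>r = \<kappa>\<close> and \<open>r = \<rho>g\<close>, where the order inequalities compare
  \<open>\<rho> * r\<close> with \<open>\<rho>f\<close>.\<close>

lemma eventually_quotient_eq:
  "eventually (\<lambda>\<sigma>. a \<sigma> / c \<sigma> powr (\<rho> * r)
      = \<alpha> (w \<sigma>) / b (w \<sigma>) powr r * (b (w \<sigma>) / c \<sigma> powr \<rho>) powr r) at_top"
  using eventually_large
proof eventually_elim
  case (elim \<sigma>)
  then show ?case
    by (simp add: powr_divide powr_powr)
qed

text \<open>A \<open>y\<close> above the lower type exceeds the quotient of \<open>w\<close> at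
  arbitrarily large \<sigma>. An inequality that holds frequently bounds a liminf by a limsup, which
  is why the indicator of \<open>g\<close> appears here.\<close>

lemma lower_type_ge:
  assumes "quot_meaningful (Liminf at_top (\<lambda>\<sigma>. ereal (a \<sigma> / c \<sigma> powr \<rho>f)))
      (Limsup at_top (\<lambda>x. ereal (\<alpha> x / b x powr \<kappa>)))"
  shows "ext_powr (Liminf at_top (\<lambda>\<sigma>. ereal (a \<sigma> / c \<sigma> powr \<rho>f))
      / Limsup at_top (\<lambda>x. ereal (\<alpha> x / b x powr \<kappa>))) (1 / \<kappa>)
    \<le> Liminf at_top (\<lambda>\<sigma>. ereal (b (w \<sigma>) / c \<sigma> powr \<rho>))"
    (is "ext_powr (?D / ?T) _ \<le> Liminf at_top ?Z")
proof (rule dense_ge)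
  fix y assume y: "Liminf at_top ?Z < y"
  show "ext_powr (?D / ?T) (1 / \<kappa>) \<le> y"
  proof (cases y)
    case (real z)
    have z: "0 < z"
      using y real types_nonneg(3)[of \<rho>] le_less_trans by fastforce
    have "frequently (\<lambda>\<sigma>. ?Z \<sigma> < y) at_top"
      using y Liminf_bounded[of y ?Z at_top] by (auto simp: frequently_def not_less)
    then have "frequently (\<lambda>\<sigma>. ereal (a \<sigma> / c \<sigma> powr \<rho>f)
        \<le> ereal (z powr \<kappa>) * ereal (\<alpha> (w \<sigma>) / b (w \<sigma>) powr \<kappa>)) at_top"
    proof (rule frequently_rev_mp)
      show "eventually (\<lambda>\<sigma>. ?Z \<sigma> < y \<longrightarrow> ereal (a \<sigma> / c \<sigma> powr \<rho>f)
          \<le> ereal (z powr \<kappa>) * ereal (\<alpha> (w \<sigma>) / b (w \<sigma>) powr \<kappa>)) at_top"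
        using eventually_large eventually_quotient_eq[of \<kappa>]
      proof eventually_elim
        case (elim \<sigma>)
        show ?case
        proof
          assume Z: "?Z \<sigma> < y"
          have "a \<sigma> / c \<sigma> powr \<rho>f \<le> a \<sigma> / c \<sigma> powr (\<rho> * \<kappa>)"
            using elim lower_order_times_order_le
            by (intro divide_left_mono powr_mono) (auto simp: mult.commute)
          also have "\<dots> \<le> \<alpha> (w \<sigma>) / b (w \<sigma>) powr \<kappa> * z powr \<kappa>"
            unfolding elim(2) using elim Z real pos
            by (intro mult_left_mono powr_mono2) auto
          finally show "ereal (a \<sigma> / c \<sigma> powr \<rho>f)
              \<le> ereal (z powr \<kappa>) * ereal (\<alpha> (w \<sigma>) / b (w \<sigma>) powr \<kappa>)"
            by (simp add: mult.commute)
        qed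
      qed
    qed
    then have "?D \<le> Limsup at_top (\<lambda>\<sigma>. ereal (z powr \<kappa>) * ereal (\<alpha> (w \<sigma>) / b (w \<sigma>) powr \<kappa>))"
      by (rule frequently_le_imp_Liminf_le_Limsup)
    also have "\<dots> = ereal (z powr \<kappa>) * Limsup at_top (\<lambda>\<sigma>. ereal (\<alpha> (w \<sigma>) / b (w \<sigma>) powr \<kappa>))"
      by (rule Limsup_ereal_mult_left) simp_all
    also have "\<dots> \<le> ereal (z powr \<kappa>) * ?T"
      by (intro ereal_mult_left_mono Limsup_filterlim_le[OF w_top]) simp
    finally show ?thesis
      unfolding real using assms z pos types_nonneg by (intro ext_powr_quotient_le)
  next
    case MInf
    with y types_nonneg(3)[of \<rho>] show ?thesis
      by simp
  qed simp
qed

text \<open>A \<open>y\<close> below the lower type is eventually below the quotient of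
  \<open>w\<close>. The resulting inequality holds eventually, so its liminf and its limsup may both
  be taken, giving the two bounds.\<close>

lemma lower_type_le:
  assumes "quot_meaningful (Liminf at_top (\<lambda>\<sigma>. ereal (a \<sigma> / c \<sigma> powr \<rho>f)))
      (Liminf at_top (\<lambda>x. ereal (\<alpha> x / b x powr \<rho>g)))"
    and "quot_meaningful (Limsup at_top (\<lambda>\<sigma>. ereal (a \<sigma> / c \<sigma> powr \<rho>f)))
      (Limsup at_top (\<lambda>x. ereal (\<alpha> x / b x powr \<rho>g)))"
  shows "Liminf at_top (\<lambda>\<sigma>. ereal (b (w \<sigma>) / c \<sigma> powr \<rho>))
    \<le> min (ext_powr (Liminf at_top (\<lambda>\<sigma>. ereal (a \<sigma> / c \<sigma> powr \<rho>f))
              / Liminf at_top (\<lambda>x. ereal (\<alpha> x / b x powr \<rho>g))) (1 / \<rho>g))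
          (ext_powr (Limsup at_top (\<lambda>\<sigma>. ereal (a \<sigma> / c \<sigma> powr \<rho>f))
              / Limsup at_top (\<lambda>x. ereal (\<alpha> x / b x powr \<rho>g))) (1 / \<rho>g))"
    (is "Liminf at_top ?Z \<le> min (ext_powr (?D / ?T) _) (ext_powr (?D' / ?T') _)")
proof (rule dense_le)
  fix y assume y: "y < Liminf at_top ?Z"
  show "y \<le> min (ext_powr (?D / ?T) (1 / \<rho>g)) (ext_powr (?D' / ?T') (1 / \<rho>g))"
  proof (cases "y \<le> 0")
    case True
    then show ?thesis
      using ext_powr_nonneg order_trans by (intro min.boundedI) blast+
  next
    case False
    with y obtain z where z: "y = ereal z" "0 < z"
      by (cases y) auto
    let ?W = "\<lambda>\<sigma>. ereal (\<alpha> (w \<sigma>) / b (w \<sigma>) powr \<rho>g)"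
    have le: "eventually (\<lambda>\<sigma>. ereal (z powr \<rho>g) * ?W \<sigma> \<le> ereal (a \<sigma> / c \<sigma> powr \<rho>f)) at_top"
      using less_LiminfD[OF y] eventually_large eventually_quotient_eq[of \<rho>g]
    proof eventually_elim
      case (elim \<sigma>)
      have "\<alpha> (w \<sigma>) / b (w \<sigma>) powr \<rho>g * z powr \<rho>g \<le> a \<sigma> / c \<sigma> powr (\<rho> * \<rho>g)"
        unfolding elim(3) using elim(1,2) z pos
        by (intro mult_left_mono powr_mono2) auto
      also have "\<dots> \<le> a \<sigma> / c \<sigma> powr \<rho>f"
        using elim order_f_le
        by (intro divide_left_mono powr_mono) (auto simp: mult.commute)
      finally show ?case
        by (simp add: mult.commute)
    qed
    have "ereal (z powr \<rho>g) * ?T \<le> ereal (z powr \<rho>g) * Liminf at_top ?W"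
      by (intro ereal_mult_left_mono Liminf_filterlim_ge[OF w_top]) simp
    also have "\<dots> = Liminf at_top (\<lambda>\<sigma>. ereal (z powr \<rho>g) * ?W \<sigma>)"
      by (rule Liminf_ereal_mult_left[symmetric]) simp_all
    also have "\<dots> \<le> ?D"
      using le by (rule Liminf_mono)
    finally have "ereal z \<le> ext_powr (?D / ?T) (1 / \<rho>g)"
      using assms(1) z pos types_nonneg by (intro le_ext_powr_quotient)
    \<comment> \<open>For the limsup, composition with \<open>w\<close> gives the wrong direction in
      general; equality comes from \<open>w'\<close>.\<close>
    moreover have "ereal (z powr \<rho>g) * ?T' = ereal (z powr \<rho>g) * Limsup at_top ?W"
      by (simp only: Limsup_filterlim_eq[OF w_top w'_top w_w', where Y = "\<lambda>x. ereal (\<alpha> x / b x powr \<rho>g)"])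
    then have "ereal (z powr \<rho>g) * ?T' = Limsup at_top (\<lambda>\<sigma>. ereal (z powr \<rho>g) * ?W \<sigma>)"
      by (simp only: Limsup_ereal_mult_left[OF trivial_limit_at_top_linorder powr_ge_zero])
    then have "ereal (z powr \<rho>g) * ?T' \<le> ?D'"
      using Limsup_mono[OF le] by simp
    then have "ereal z \<le> ext_powr (?D' / ?T') (1 / \<rho>g)"
      using assms(2) z pos types_nonneg by (intro le_ext_powr_quotient)
    ultimately show ?thesis
      using z by simp
  qed
qed

end

section \<open>Iterated logarithms and the relative types\<close>

text \<open>At \<open>k = 0\<close> the inner function is \<open>exp\<close>, whose index is -1, and
  \<open>ln\<close> undoes it.\<close>

lemma ln_iter_log: "0 \<le> k \<Longrightarrow> ln (iter_log (k - 1) x) = iter_log k x"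
proof (cases "k = 0")
  case False
  assume "0 \<le> k"
  with False have "nat k = Suc (nat (k - 1))"
    by simp
  with False \<open>0 \<le> k\<close> show ?thesis
    by (simp add: iter_log_def)
qed (simp add: iter_log_def)

lemma iter_log_at_top: "filterlim (iter_log k) at_top at_top"
proof -
  have "filterlim (f ^^ n) at_top at_top" if "filterlim f at_top at_top" for f :: "real \<Rightarrow> real" and n
    using that by (induction n) (auto simp: filterlim_ident comp_def id_def intro: filterlim_compose)
  then show ?thesis
    unfolding iter_log_def using ln_at_top exp_at_top by (cases "0 \<le> k") auto
qed

theorem theorem4:
  fixes f :: "complex \<Rightarrow> 'a::complex_banach"
    and g :: "complex \<Rightarrow> 'b::complex_banach"
    and h :: "complex \<Rightarrow> 'c::complex_banach"
    and p q m :: int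
  assumes "p \<ge> 0" and "q \<ge> 0" and "m \<ge> 0"
    and "vvds_entire f" and "vvds_entire g" and "vvds_entire h"
    and "rel_index_pair h m q f"
    and "rel_index_pair h m p g"
    and "pos_finite (rel_lower_order h m p g)"
    and "pos_finite (rel_order g p q f)"
    and "quot_meaningful (rel_lower_type h m q f) (rel_weak_type_indicator h m p g)"
    and "quot_meaningful (rel_lower_type h m q f) (rel_lower_type h m p g)"
    and "quot_meaningful (rel_type h m q f) (rel_type h m p g)"
  shows "ext_powr (rel_lower_type h m q f / rel_weak_type_indicator h m p g)
           (1 / real_of_ereal (rel_lower_order h m p g))
         \<le> rel_lower_type g p q f
       \<and> rel_lower_type g p q f
         \<le> min (ext_powr (rel_lower_type h m q f / rel_lower_type h m p g)
                  (1 / real_of_ereal (rel_order h m p g)))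
               (ext_powr (rel_type h m q f / rel_type h m p g)
                  (1 / real_of_ereal (rel_order h m p g)))"
proof -
  \<comment> \<open>The lower bound in a relative index-pair is 0 or 1, so it yields positivity
    either way.\<close>
  have pos: "pos_finite (rel_order h m q f)" "pos_finite (rel_order h m p g)"
    using assms(7,8) by (auto simp: rel_index_pair_def pos_finite_def split: if_splits
        intro: less_trans[of 0 1])
  have real: "ereal (real_of_ereal x) = x" "0 < real_of_ereal x" if "pos_finite x" for x
    using that by (cases x; auto simp: pos_finite_def)+
  note F = vvds_growth_function[OF \<open>vvds_entire f\<close>]
    and G = vvds_growth_function[OF \<open>vvds_entire g\<close>]
    and H = vvds_growth_function[OF \<open>vvds_entire h\<close>]
  have F_top: "filterlim (max_modulus f) at_top at_top" and G_top: "filterlim (max_modulus g) at_top at_top"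
    using F G by (auto simp: growth_function_def)
  have F_pos: "eventually (\<lambda>\<sigma>. 0 < max_modulus f \<sigma>) at_top"
    and G_pos: "eventually (\<lambda>x. 0 < max_modulus g x) at_top"
    using F_top G_top by (auto simp: filterlim_at_top_dense)
  let ?A = "iter_log (m - 1)" and ?B = "iter_log (p - 1)" and ?C = "iter_log (q - 1)"
  \<comment> \<open>Taking \<open>ln\<close> raises the indices \<open>m - 1\<close>,
    \<open>p - 1\<close>, \<open>q - 1\<close> by one, which turns the order assumptions into the
    relative orders.\<close>
  interpret composed_growth "\<lambda>\<sigma>. ?A (rel_modulus h f \<sigma>)" "\<lambda>x. ?A (rel_modulus h g x)" ?B ?C
    "rel_modulus g f" "rel_modulus f g"
    "real_of_ereal (rel_order h m q f)" "real_of_ereal (rel_order h m p g)"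
    "real_of_ereal (rel_lower_order h m p g)" "real_of_ereal (rel_order g p q f)"
  proof
    show "eventually (\<lambda>\<sigma>. ?A (rel_modulus h f \<sigma>) = ?A (rel_modulus h g (rel_modulus g f \<sigma>))) at_top"
      using F_pos by eventually_elim (simp add: rel_modulus_def growth_function_inv[OF G])
    show "eventually (\<lambda>x. rel_modulus g f (rel_modulus f g x) = x) at_top"
      using G_pos
    proof eventually_elim
      case (elim x)
      then have "max_modulus g (rel_modulus g f (rel_modulus f g x)) = max_modulus g x"
        by (simp add: rel_modulus_def growth_function_inv[OF F] growth_function_inv[OF G])
      then show ?case
        using elim growth_function_unique[OF G] by blast
    qed
    show "filterlim (rel_modulus g f) at_top at_top" "filterlim (rel_modulus f g) at_top at_top"
      unfolding rel_modulus_def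
      by (rule growth_function_inv_at_top[OF G F_top] growth_function_inv_at_top[OF F G_top])+
    show "filterlim (\<lambda>x. ?A (rel_modulus h g x)) at_top at_top"
      unfolding rel_modulus_def
      by (rule filterlim_compose[OF iter_log_at_top growth_function_inv_at_top[OF H G_top]])
  qed (use assms pos real in \<open>auto simp: iter_log_at_top ln_iter_log rel_order_def rel_lower_order_def\<close>)
  show ?thesis
    using lower_type_ge lower_type_le assms
    unfolding rel_type_def rel_lower_type_def rel_weak_type_indicator_def by blast
qed

end
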